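(* Let $d \ge 1$ and let $S \subseteq \mathbb{R}^d$ be a $d$-dimensional simplex (not necessarily a lattice simplex) whose interior contains exactly $k \ge 0$ points of $\mathbb{Z}^d$. Assume that $S$ has a facet $F$ whose relative interior contains exactly one point $x$ of $\mathbb{Z}^d$. Let $\beta_1, \ldots, \beta_d > 0$ be the barycentric coordinates of $x$ with respect to the $(d-1)$-dimensional simplex $F$. Then: (a) $\operatorname{vol}(S) \le \dfrac{k+1}{d!\,\beta_1 \cdots \beta_d}$. (b) If $k \ge 1$ and the inequality in (a) holds with equality, then (1) there exists a line $g \subseteq \mathbb{R}^d$ that contains $x$ and all points of $\mathbb{Z}^d$ lying in the interior of $S$, and (2) $S$ has an edge parallel to the line $g$.
   Context: $\operatorname{vol}$ denotes $d$-dimensional Lebesgue measure, normalized so that $[0,1]^d$ has volume $1$. If $F=\operatorname{conv}(v_1,\ldots,v_d)$ with $v_1,\ldots,v_d$ affinely independent, the barycentric coordinates of a point $x$ in the affine hull of $F$ are the unique reals $\beta_1,\ldots,\beta_d$ with $\beta_1+\cdots+\beta_d=1$ and $x=\beta_1 v_1+\cdots+\beta_d v_d$; they are all positive exactly when $x$ lies in the relative interior of $F$ (the interior of $F$ with respect to its affine hull). *)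

theory Defs
  imports "HOL-Analysis.Analysis"
begin

definition integer_lattice :: "(real ^ 'n) set" where
  "integer_lattice = {x. \<forall>i. x $ i \<in> \<int>}"

text \<open>The coordinates are indexed by the vertices themselves. They are unique on \<open>V\<close> when
  \<open>V\<close> is affinely independent; values of \<open>\<beta>\<close> outside \<open>V\<close> are irrelevant.\<close>

definition barycentric_coordinates ::
    "'a::real_vector set \<Rightarrow> 'a \<Rightarrow> ('a \<Rightarrow> real) \<Rightarrow> bool" where
  "barycentric_coordinates V x \<beta> \<longleftrightarrow> sum \<beta> V = 1 \<and> x = (\<Sum>v\<in>V. \<beta> v *\<^sub>R v)"

definition is_line :: "'a::euclidean_space set \<Rightarrow> bool" where
  "is_line g \<longleftrightarrow> affine g \<and> aff_dim g = 1"

text \<open>\<open>affine_parallel\<close> relates translates of the same set, so the edge is replaced by the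
  line it spans.\<close>

definition has_edge_parallel_to :: "'a::euclidean_space set \<Rightarrow> 'a set \<Rightarrow> bool" where
  "has_edge_parallel_to S g \<longleftrightarrow> (\<exists>e. e edge_of S \<and> affine_parallel (affine hull e) g)"

end

theory Submission
  imports Defs
begin

text \<open>
  Let \<open>p\<close> be the vertex of \<open>S\<close> opposite to \<open>F\<close> and \<open>h\<^sub>1, \<dots>, h\<^sub>d\<close> the vertices of \<open>F\<close>. In the coordinates of the
  basis \<open>h\<^sub>i - p\<close> the open box \<open>M = {y. \<bar>y\<^sub>i\<bar> < \<beta>\<^sub>i / 2}\<close> has volume \<open>d! vol(S) \<beta>\<^sub>1 \<cdots> \<beta>\<^sub>d\<close>. If \<open>w\<close> is
  a nonzero lattice vector joining two points of \<open>M\<close>, then the barycentric coordinates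
  \<open>\<beta>\<^sub>i + w\<^sub>i\<close> of \<open>x + w\<close> are positive, and its coordinate at \<open>p\<close> is \<open>l(w) = - (w\<^sub>1 + \<cdots> + w\<^sub>d)\<close>, which is not
  \<open>0\<close> because \<open>x\<close> is the only lattice point inside \<open>F\<close>; so \<open>x + w\<close> or \<open>x - w\<close> lies in the
  interior of \<open>S\<close>. Subtracting the \<open>l\<close>-minimal point shows that a translate of the lattice has at
  most \<open>k + 1\<close> points in \<open>M\<close>; averaging over all translates gives \<open>vol(M) \<le> k + 1\<close>.

  In case of equality almost every translate has exactly \<open>k + 1\<close> points in \<open>M\<close>. All positive
  differences of these points are among the \<open>k\<close> interior vectors, which forces the points to be
  consecutive terms of an arithmetic progression with a step \<open>u\<close> not depending on the translate. If \<open>u\<close> had two nonzero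
  coordinates, then points \<open>y\<close> near a suitable corner of the box would satisfy \<open>y \<plusminus> u \<notin> M\<close>; hence
  \<open>u\<close> is parallel to one of the edges \<open>h\<^sub>i - p\<close>.
\<close>

section \<open>Lebesgue measure under translations and linear maps\<close>

lemma nn_integral_lborel_shift:
  fixes f :: "'a::euclidean_space \<Rightarrow> ennreal"
  assumes [measurable]: "f \<in> borel_measurable borel"
  shows "(\<integral>\<^sup>+y. f (a + y) \<partial>lborel) = (\<integral>\<^sup>+y. f y \<partial>lborel)"
proof -
  have "(\<integral>\<^sup>+y. f y \<partial>lborel) = (\<integral>\<^sup>+y. f y \<partial>distr lborel borel ((+) a))"
    by (simp add: lborel_distr_plus)
  then show ?thesis by (simp add: nn_integral_distr)
qed

text \<open>
  Uniqueness of Haar measure via Tonelli. It replaces the determinant formula, which the library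
  only has for index types of class \<open>wellorder\<close>.
\<close>

lemma emeasure_linear_vimage_proportional:
  fixes T c :: "'a::euclidean_space \<Rightarrow> 'a"
  assumes "linear T" "linear c" and cT: "\<And>y. c (T y) = y"
    and A[measurable]: "A \<in> sets borel" and B[measurable]: "B \<in> sets borel"
  shows "emeasure lborel (c -` A) * emeasure lborel B = emeasure lborel (c -` B) * emeasure lborel A"
proof -
  have T[measurable]: "T \<in> borel_measurable borel" and c[measurable]: "c \<in> borel_measurable borel"
    using assms by (auto intro!: borel_measurable_continuous_onI linear_continuous_on linear_linear simp: linear_linear)
  have cadd: "c (a + b) = c a + c b" "c (a - b) = c a - c b" for a b
    using \<open>linear c\<close> by (auto simp: linear_add linear_diff)
  have reflect: "(\<integral>\<^sup>+y. f (- y) \<partial>lborel) = (\<integral>\<^sup>+y. f y \<partial>lborel)"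
    if [measurable]: "f \<in> borel_measurable borel" for f :: "'a \<Rightarrow> ennreal"
  proof -
    have "(\<integral>\<^sup>+y. f y \<partial>lborel) = (\<integral>\<^sup>+y. f y \<partial>distr lborel borel uminus)"
      using lborel_affine[of "- 1" "0 :: 'a"] by (simp add: density_1)
    then show ?thesis by (simp add: nn_integral_distr)
  qed
  have cA[measurable]: "c -` A \<in> sets borel" "c -` B \<in> sets borel"
    using measurable_sets[OF c A] measurable_sets[OF c B] by auto
  have "emeasure lborel (c -` A) * emeasure lborel B
      = (\<integral>\<^sup>+x. indicator (c -` A) x * emeasure lborel B \<partial>lborel)"
    by (simp add: nn_integral_multc)
  also have "\<dots> = (\<integral>\<^sup>+x. (\<integral>\<^sup>+y. indicator A (c x) * indicator B (c x + y) \<partial>lborel) \<partial>lborel)"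
    by (simp add: nn_integral_cmult nn_integral_lborel_shift[of "indicator B"] indicator_vimage)
  also have "\<dots> = (\<integral>\<^sup>+y. (\<integral>\<^sup>+x. indicator A (c x) * indicator B (c x + y) \<partial>lborel) \<partial>lborel)"
    by (rule lborel_pair.Fubini') measurable
  also have "\<dots> = (\<integral>\<^sup>+y. (\<integral>\<^sup>+x. indicator A (c x - y) * indicator B (c x) \<partial>lborel) \<partial>lborel)"
  \<comment> \<open>Substitute \<open>x + T y\<close> for \<open>x\<close>. As
    \<open>c (T y) = y\<close>, this moves the shift by \<open>y\<close> from the argument of
    \<open>B\<close> to that of \<open>A\<close>, so that the roles of the two sets are
    exchanged.\<close>
  proof (rule nn_integral_cong)
    fix y
    show "(\<integral>\<^sup>+x. indicator A (c x) * indicator B (c x + y) \<partial>lborel)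
      = (\<integral>\<^sup>+x. indicator A (c x - y) * indicator B (c x) \<partial>lborel)"
      by (subst nn_integral_lborel_shift[where a = "T y" and f = "\<lambda>x. indicator A (c x - y) * indicator B (c x)", symmetric])
         (simp_all add: cadd cT add.commute)
  qed
  also have "\<dots> = (\<integral>\<^sup>+x. (\<integral>\<^sup>+y. indicator A (c x - y) * indicator B (c x) \<partial>lborel) \<partial>lborel)"
    by (rule lborel_pair.Fubini') measurable
  also have "\<dots> = (\<integral>\<^sup>+x. indicator (c -` B) x * emeasure lborel A \<partial>lborel)"
  proof (rule nn_integral_cong)
    fix x
    have "(\<integral>\<^sup>+y. indicator A (c x - y) \<partial>lborel) = (\<integral>\<^sup>+y. indicator A (c x + y) \<partial>lborel)"
      using reflect[of "\<lambda>y. indicator A (c x + y)"] by simp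
    also have "\<dots> = emeasure lborel A"
      by (simp add: nn_integral_lborel_shift)
    finally show "(\<integral>\<^sup>+y. indicator A (c x - y) * indicator B (c x) \<partial>lborel) = indicator (c -` B) x * emeasure lborel A"
      by (simp add: nn_integral_multc mult.commute indicator_def)
  qed
  also have "\<dots> = emeasure lborel (c -` B) * emeasure lborel A"
    by (simp add: nn_integral_multc)
  finally show ?thesis .
qed

section \<open>Averaging lattice point counts over translates\<close>

lemma countable_integer_lattice: "countable (integer_lattice :: (real ^ 'n) set)"
proof -
  have "integer_lattice \<subseteq> range (\<lambda>f. \<chi> i. of_int (f i) :: real ^ 'n)"
  proof
    fix x :: "real ^ 'n" assume "x \<in> integer_lattice"
    then have "x = (\<chi> i. of_int \<lfloor>x $ i\<rfloor>)" by (simp add: integer_lattice_def vec_eq_iff)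
    then show "x \<in> range (\<lambda>f. \<chi> i. of_int (f i) :: real ^ 'n)"
      by (rule image_eqI[where x = "\<lambda>i. \<lfloor>x $ i\<rfloor>"]) simp
  qed
  then show ?thesis
    by (rule countable_subset) simp
qed

lemma integer_lattice_add: "a \<in> integer_lattice \<Longrightarrow> b \<in> integer_lattice \<Longrightarrow> a + b \<in> integer_lattice"
  and integer_lattice_diff: "a \<in> integer_lattice \<Longrightarrow> b \<in> integer_lattice \<Longrightarrow> a - b \<in> integer_lattice"
  and integer_lattice_0: "0 \<in> integer_lattice"
  by (auto simp: integer_lattice_def)

text \<open>The part of the coset \<open>y + integer_lattice\<close> inside \<open>M\<close>. Its
  points stay in place instead of being shifted back to the lattice, so the set depends only on the
  coset of \<open>y\<close>.\<close>

definition lattice_translates :: "(real ^ 'n) set \<Rightarrow> real ^ 'n \<Rightarrow> (real ^ 'n) set" where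
  "lattice_translates M y = {a\<in>M. a - y \<in> integer_lattice}"

lemma lattice_translates_shift:
  assumes "y' - y \<in> integer_lattice"
  shows "lattice_translates M y' = lattice_translates M y"
proof -
  have "a - y' \<in> integer_lattice \<longleftrightarrow> a - y \<in> integer_lattice" for a
    using integer_lattice_add[OF _ assms, of "a - y'"] integer_lattice_diff[OF _ assms, of "a - y"]
    by (auto simp: algebra_simps)
  then show ?thesis by (simp add: lattice_translates_def)
qed

lemma nn_integral_lattice_indicator:
  assumes "finite (lattice_translates M y)"
  shows "(\<integral>\<^sup>+z. indicator M (y + z) \<partial>count_space integer_lattice) = of_nat (card (lattice_translates M y))"
proof -
  let ?Z = "(\<lambda>a. a - y) ` lattice_translates M y"
  have Z: "?Z = {z \<in> integer_lattice. y + z \<in> M}"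
    by (auto simp: lattice_translates_def image_iff intro!: exI[of _ "y + _"])
  have "(\<integral>\<^sup>+z. indicator M (y + z) \<partial>count_space integer_lattice) = (\<integral>\<^sup>+z. indicator ?Z z \<partial>count_space integer_lattice)"
    by (rule nn_integral_cong) (auto simp: Z indicator_def)
  also have "\<dots> = emeasure (count_space integer_lattice) ?Z"
    by (rule nn_integral_indicator) (auto simp: Z)
  also have "\<dots> = of_nat (card ?Z)"
    by (rule emeasure_count_space_finite) (use Z assms in \<open>blast, metis finite_imageI\<close>)
  also have "card ?Z = card (lattice_translates M y)"
    by (rule card_image) (simp add: inj_on_def)
  finally show ?thesis .
qed

lemma lattice_fractional_part_unique:
  fixes x :: "real ^ 'n"
  assumes z: "z \<in> integer_lattice"
  shows "(\<forall>i. 0 \<le> (x - z) $ i \<and> (x - z) $ i < 1) \<longleftrightarrow> z = (\<chi> i. of_int \<lfloor>x $ i\<rfloor>)"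
proof -
  have "(0 \<le> (x - z) $ i \<and> (x - z) $ i < 1) \<longleftrightarrow> z $ i = of_int \<lfloor>x $ i\<rfloor>" for i
  proof -
    obtain n where n: "z $ i = of_int n" using z by (auto simp: integer_lattice_def elim: Ints_cases)
    show ?thesis unfolding n vector_minus_component by (simp add: floor_eq_iff eq_commute[of n]) linarith
  qed
  then show ?thesis by (simp add: vec_eq_iff)
qed

text \<open>The lattice translates of the half-open unit cube \<open>Q\<close> tile the space, so
  the integral of \<open>f\<close> is the integral over \<open>Q\<close> of the sum of
  \<open>f\<close> along cosets. That sum is at most \<open>C\<close>, and \<open>Q\<close> has
  volume at most 1.\<close>

lemma nn_integral_le_if_lattice_sum_le:
  fixes f :: "real ^ 'n \<Rightarrow> ennreal"
  assumes f[measurable]: "f \<in> borel_measurable borel"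
    and le: "\<And>y. (\<integral>\<^sup>+z. f (y + z) \<partial>count_space integer_lattice) \<le> C"
  shows "(\<integral>\<^sup>+x. f x \<partial>lborel) \<le> C"
proof -
  define Q where "Q = {y :: real ^ 'n. \<forall>i. 0 \<le> y $ i \<and> y $ i < 1}"
  have Q[measurable]: "Q \<in> sets borel"
    unfolding Q_def by measurable
  have "Q \<subseteq> cbox 0 1" by (auto simp: Q_def mem_box_cart less_imp_le)
  then have "emeasure lborel Q \<le> emeasure lborel (cbox (0 :: real ^ 'n) 1)"
    by (intro emeasure_mono) auto
  also have "\<dots> = 1"
    by (auto simp: emeasure_lborel_cbox_eq Basis_vec_def inner_axis intro!: prod.neutral)
  finally have Q1: "emeasure lborel Q \<le> 1" .
  have one: "(\<integral>\<^sup>+z. indicator Q (x - z) \<partial>count_space integer_lattice) = (1::ennreal)" for x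
  proof -
    let ?z = "\<chi> i. of_int \<lfloor>x $ i\<rfloor>"
    have mem: "?z \<in> integer_lattice" by (simp add: integer_lattice_def)
    have "(\<integral>\<^sup>+z. indicator Q (x - z) \<partial>count_space integer_lattice)
        = (\<integral>\<^sup>+z. indicator {?z} z \<partial>count_space integer_lattice)"
      by (rule nn_integral_cong) (auto simp: Q_def indicator_def lattice_fractional_part_unique simp del: vector_minus_component)
    also have "\<dots> = emeasure (count_space integer_lattice) {?z}"
      by (rule nn_integral_indicator) (use mem in auto)
    also have "\<dots> = 1" using mem by (subst emeasure_count_space_finite) auto
    finally show ?thesis .
  qed
  have "(\<integral>\<^sup>+x. f x \<partial>lborel) = (\<integral>\<^sup>+x. \<integral>\<^sup>+z. f x * indicator Q (x - z) \<partial>count_space integer_lattice \<partial>lborel)"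
    by (simp add: nn_integral_cmult one)
  also have "\<dots> = (\<integral>\<^sup>+z. \<integral>\<^sup>+x. f x * indicator Q (x - z) \<partial>lborel \<partial>count_space integer_lattice)"
    by (rule nn_integral_count_space_nn_integral) (auto simp: countable_integer_lattice)
  also have "\<dots> = (\<integral>\<^sup>+z. \<integral>\<^sup>+x. f (x + z) * indicator Q x \<partial>lborel \<partial>count_space integer_lattice)"
  proof (rule nn_integral_cong)
    fix z :: "real ^ 'n"
    show "(\<integral>\<^sup>+x. f x * indicator Q (x - z) \<partial>lborel) = (\<integral>\<^sup>+x. f (x + z) * indicator Q x \<partial>lborel)"
      by (subst nn_integral_lborel_shift[of "\<lambda>x. f x * indicator Q (x - z)" z, symmetric]) (simp_all add: add.commute)
  qed
  also have "\<dots> = (\<integral>\<^sup>+x. \<integral>\<^sup>+z. f (x + z) * indicator Q x \<partial>count_space integer_lattice \<partial>lborel)"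
    by (rule nn_integral_count_space_nn_integral[symmetric]) (auto simp: countable_integer_lattice)
  also have "\<dots> \<le> (\<integral>\<^sup>+x. C * indicator Q x \<partial>lborel)"
    by (intro nn_integral_mono) (auto simp: nn_integral_multc le mult_right_mono)
  also have "\<dots> = C * emeasure lborel Q" by (simp add: nn_integral_cmult)
  also have "\<dots> \<le> C * 1" by (intro mult_left_mono Q1) auto
  finally show ?thesis by simp
qed

lemma lattice_point_in_unit_ball:
  assumes "z \<in> integer_lattice" "norm z < 1"
  shows "z = (0 :: real ^ 'n)"
proof -
  have "z $ i = 0" for i
  proof -
    obtain n where n: "z $ i = of_int n" using assms by (auto simp: integer_lattice_def elim: Ints_cases)
    have "\<bar>z $ i\<bar> < 1" using component_le_norm_cart[of z i] assms by linarith
    then show ?thesis unfolding n by simp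
  qed
  then show ?thesis by (simp add: vec_eq_iff)
qed

text \<open>Blichfeldt's theorem in contrapositive form: the volume of \<open>M\<close> is the
  average over cosets of the number of their points in \<open>M\<close>.\<close>

lemma lattice_covering_volume_le:
  assumes [measurable]: "M \<in> sets borel"
    and "\<And>y. finite (lattice_translates M y)" "\<And>y. card (lattice_translates M y) \<le> m"
  shows "emeasure lborel M \<le> of_nat m"
proof -
  have "(\<integral>\<^sup>+x. indicator M x \<partial>lborel) \<le> of_nat m"
    by (rule nn_integral_le_if_lattice_sum_le) (simp_all add: nn_integral_lattice_indicator assms)
  then show ?thesis by simp
qed

text \<open>If every coset through \<open>G\<close> fell short of \<open>m\<close> points, a small
  nonempty open part of \<open>G\<close> could be counted in addition to \<open>M\<close> with all
  coset counts still at most \<open>m\<close>. The averaging bound would then force an open nonempty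
  set to have measure 0.\<close>

lemma lattice_covering_extremal:
  fixes M :: "(real ^ 'n) set"
  assumes M[measurable]: "M \<in> sets borel"
    and fin: "\<And>y. finite (lattice_translates M y)" and le: "\<And>y. card (lattice_translates M y) \<le> m"
    and vol: "emeasure lborel M = of_nat m"
    and G: "open G" "G \<noteq> {}"
  shows "\<exists>y\<in>G. card (lattice_translates M y) = m"
proof (rule ccontr)
  assume "\<not> ?thesis"
  with le have less: "Suc (card (lattice_translates M y)) \<le> m" if "y \<in> G" for y
    using that by (metis Suc_leI le_neq_implies_less)
  obtain y0 where y0: "y0 \<in> G" using G by blast
  \<comment> \<open>Radius \<open>1/2\<close> puts points of \<open>H\<close> at distance less than
    1, so each coset meets \<open>H\<close> at most once.\<close>
  define H where "H = G \<inter> ball y0 (1/2)"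
  have H: "open H" "y0 \<in> H" using G y0 by (auto simp: H_def)
  then have [measurable]: "H \<in> sets borel" by (simp add: borel_open)
  have eq: "a = b" if "a \<in> H" "b \<in> H" "a - b \<in> integer_lattice" for a b
  proof -
    have "dist a b < 1" using that(1,2) unfolding H_def
      by (smt (verit, best) IntD2 dist_triangle_half_r dist_commute mem_ball)
    then show ?thesis using lattice_point_in_unit_ball[OF that(3)] by (simp add: dist_norm)
  qed
  have sub: "lattice_translates H y \<subseteq> {a}" if a: "a \<in> lattice_translates H y" for a y
  proof
    fix b assume "b \<in> lattice_translates H y"
    then have "b \<in> H" "b - y \<in> integer_lattice" by (auto simp: lattice_translates_def)
    moreover have "a \<in> H" "a - y \<in> integer_lattice" using a by (auto simp: lattice_translates_def)
    ultimately show "b \<in> {a}" using eq[of b a] integer_lattice_diff[of "b - y" "a - y"] by simp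
  qed
  have finH: "finite (lattice_translates H y)" for y
    using sub by (metis finite.emptyI finite_insert finite_subset ex_in_conv)
  have tot: "card (lattice_translates M y) + card (lattice_translates H y) \<le> m" for y
  proof (cases "lattice_translates H y = {}")
    case True then show ?thesis using le by simp
  next
    case False
    then obtain a where a: "a \<in> lattice_translates H y" by blast
    have "card (lattice_translates H y) \<le> 1" using card_mono[OF _ sub[OF a]] by simp
    moreover have "Suc (card (lattice_translates M a)) \<le> m"
      using a less by (auto simp: lattice_translates_def H_def)
    moreover have "lattice_translates M a = lattice_translates M y"
      using a by (intro lattice_translates_shift) (auto simp: lattice_translates_def)
    ultimately show ?thesis by simp
  qed
  \<comment> \<open>A translate meeting \<open>H\<close> has a point to spare, so \<open>H\<close> can be counted twice.\<close>
  have "(\<integral>\<^sup>+x. indicator M x + indicator H x \<partial>lborel) \<le> of_nat m"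
  proof (rule nn_integral_le_if_lattice_sum_le)
    fix y :: "real ^ 'n"
    have "(\<integral>\<^sup>+z. indicator M (y + z) + indicator H (y + z) \<partial>count_space integer_lattice)
       = of_nat (card (lattice_translates M y) + card (lattice_translates H y))"
      by (simp add: nn_integral_add nn_integral_lattice_indicator fin finH)
    also have "\<dots> \<le> (of_nat m :: ennreal)" using tot[of y] by (simp only: of_nat_le_iff)
    finally show "(\<integral>\<^sup>+z. indicator M (y + z) + indicator H (y + z) \<partial>count_space integer_lattice) \<le> of_nat m" .
  qed simp
  then have "of_nat m + emeasure lborel H \<le> of_nat m"
    by (simp add: nn_integral_add vol)
  then have "emeasure lborel H = 0"
    using ennreal_add_left_cancel_le[of "of_nat m" "emeasure lborel H" 0] by simp
  then have "H \<in> null_sets lebesgue"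
    by (intro null_sets_completionI) (simp add: null_sets_def)
  then have "negligible H" by (simp add: negligible_iff_null_sets)
  then show False using open_not_negligible[OF H(1)] H(2) by blast
qed

section \<open>Finite sets whose positive differences lie in a given set\<close>

text \<open>Subtracting the \<open>l\<close>-minimal point \<open>q\<close> is injective, and by
  injectivity of \<open>l\<close> all other points lie strictly above \<open>q\<close>. This yields
  the bound \<open>card A \<le> Suc (card D)\<close>.\<close>

lemma minimal_element_differences:
  fixes l :: "'a::ab_group_add \<Rightarrow> 'b::linorder"
  assumes "finite D" "finite A" and inj: "inj_on l A"
    and diff: "\<And>a b. a \<in> A \<Longrightarrow> b \<in> A \<Longrightarrow> l a < l b \<Longrightarrow> b - a \<in> D"
    and "A \<noteq> {}"
  obtains q where "q \<in> A" "\<And>a. a \<in> A \<Longrightarrow> a \<noteq> q \<Longrightarrow> l q < l a" "(\<lambda>a. a - q) ` (A - {q}) \<subseteq> D" "card A = Suc (card ((\<lambda>a. a - q) ` (A - {q})))"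
proof -
  have "Min (l ` A) \<in> l ` A" using assms by (intro Min_in) auto
  then obtain q where q: "q \<in> A" "l q = Min (l ` A)" by auto
  have less: "l q < l a" if "a \<in> A" "a \<noteq> q" for a
  proof -
    have "l q \<le> l a" using that q assms by simp
    moreover have "l q \<noteq> l a" using that q inj by (auto simp: inj_on_def)
    ultimately show ?thesis by simp
  qed
  moreover have "(\<lambda>a. a - q) ` (A - {q}) \<subseteq> D"
    using less q(1) diff by blast
  moreover have "card A = Suc (card ((\<lambda>a. a - q) ` (A - {q})))"
    using q(1) \<open>finite A\<close> by (subst card_image) (auto simp: inj_on_def card.remove simp del: card_Diff_insert)
  ultimately show ?thesis using q that by blast
qed

text \<open>Equality of cardinalities makes \<open>A\<close> the translate by \<open>q\<close> of
  \<open>D\<close> together with 0. For \<open>w\<close> in \<open>D\<close> other than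
  \<open>u\<close>, the difference of \<open>q + w\<close> and \<open>q + u\<close> is again
  positive, so \<open>w - u\<close> lies in \<open>D\<close>. Descending by steps \<open>u\<close>
  shows that \<open>D\<close> consists of multiples of \<open>u\<close>, and that every point of
  \<open>A\<close> has a neighbour at distance one step.\<close>

lemma difference_chain_extremal:
  fixes l :: "'a::real_vector \<Rightarrow> real"
  assumes "linear l" "finite D" "finite A" and inj: "inj_on l A"
    and diff: "\<And>a b. a \<in> A \<Longrightarrow> b \<in> A \<Longrightarrow> l a < l b \<Longrightarrow> b - a \<in> D"
    and card: "card A = Suc (card D)"
    and u: "u \<in> D" "\<And>w. w \<in> D \<Longrightarrow> l u \<le> l w"
  shows "\<And>w. w \<in> D \<Longrightarrow> \<exists>n::nat. w = real n *\<^sub>R u"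
    and "\<And>a. a \<in> A \<Longrightarrow> a + u \<in> A \<or> a - u \<in> A"
    and "0 < l u"
proof -
  obtain q where q: "q \<in> A" "\<And>a. a \<in> A \<Longrightarrow> a \<noteq> q \<Longrightarrow> l q < l a" "(\<lambda>a. a - q) ` (A - {q}) \<subseteq> D" "card A = Suc (card ((\<lambda>a. a - q) ` (A - {q})))"
    by (rule minimal_element_differences[OF assms(2,3) inj diff]) (use card in auto)
  then have "(\<lambda>a. a - q) ` (A - {q}) = D"
    using card \<open>finite D\<close> by (intro card_subset_eq) auto
  then have D: "w \<in> D \<longleftrightarrow> q + w \<in> A \<and> w \<noteq> 0" for w
    by (force simp: image_iff)
  have step: "w - u \<in> D" if "w \<in> D" "w \<noteq> u" for w
  proof -
    have "l u \<noteq> l w"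
      using inj that D u(1) \<open>linear l\<close> unfolding inj_on_def
      by (metis add_left_cancel linear_add)
    then have "l (q + u) < l (q + w)" using u(2)[OF that(1)] \<open>linear l\<close> by (simp add: linear_add)
    then have "(q + w) - (q + u) \<in> D" using diff D that u(1) by blast
    then show ?thesis by simp
  qed
  show lu: "0 < l u"
    using q(2)[of "q + u"] D[of u] u(1) \<open>linear l\<close> by (simp add: linear_add)
  show "\<exists>n::nat. w = real n *\<^sub>R u" if "w \<in> D" for w
    using that
  \<comment> \<open>The values of \<open>l\<close> are real, so the descent is measured by the
    finite number of elements of \<open>D\<close> below \<open>w\<close>.\<close>
  proof (induction "card {w'\<in>D. l w' < l w}" arbitrary: w rule: less_induct)
    case (less w)
    show ?case
    proof (cases "w = u")
      case True then show ?thesis by (intro exI[of _ 1]) simp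
    next
      case False
      have lt: "l (w - u) < l w" using lu \<open>linear l\<close> by (simp add: linear_diff)
      have mem: "w - u \<in> D" using step less.prems False by blast
      have "card {w'\<in>D. l w' < l (w - u)} < card {w'\<in>D. l w' < l w}"
        using lt mem \<open>finite D\<close> by (intro psubset_card_mono) auto
      from less.hyps[OF this mem] obtain n :: nat where "w - u = real n *\<^sub>R u" by blast
      then show ?thesis by (intro exI[of _ "Suc n"]) (simp add: algebra_simps)
    qed
  qed
  show "a + u \<in> A \<or> a - u \<in> A" if "a \<in> A" for a
  proof (cases "a = q")
    case True then show ?thesis using D u(1) by simp
  next
    case False
    then have w: "a - q \<in> D" using D that by simp
    show ?thesis
    proof (cases "a - q = u")
      case True then show ?thesis using q(1) by (simp add: algebra_simps)
    next
      case False
      from step[OF w this] show ?thesis using D[of "a - q - u"] by (simp add: algebra_simps)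
    qed
  qed
qed

text \<open>Integer coordinates in a bounded range leave finitely many choices. This serves both the
  traces of cosets on the box and, with \<open>y = 0\<close>, the lattice points inside the
  simplex.\<close>

lemma finite_bounded_lattice_translates:
  assumes "bounded M"
  shows "finite (lattice_translates M y)"
proof -
  obtain B where B: "\<And>a. a \<in> M \<Longrightarrow> norm a \<le> B" using assms by (auto simp: bounded_iff)
  define n where "n = \<lceil>B + norm y\<rceil>"
  have "lattice_translates M y \<subseteq> (\<lambda>f. y + (\<chi> i. of_int (f i))) ` (PiE UNIV (\<lambda>_. {-n..n}))"
  proof
    fix a assume a: "a \<in> lattice_translates M y"
    have eq: "a = y + (\<chi> i. of_int \<lfloor>(a - y) $ i\<rfloor>)"
      using a by (simp add: lattice_translates_def integer_lattice_def vec_eq_iff)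
    have "\<bar>(a - y) $ i\<bar> \<le> n" for i
      using component_le_norm_cart[of "a - y" i] norm_triangle_ineq4[of a y] B[of a] a
      unfolding n_def lattice_translates_def
      by (smt (verit, best) le_of_int_ceiling mem_Collect_eq)
    then have "(\<lambda>i. \<lfloor>(a - y) $ i\<rfloor>) \<in> PiE UNIV (\<lambda>_. {-n..n})"
      by (auto simp: abs_le_iff floor_le_iff le_floor_iff) (smt (verit, best))+
    with eq show "a \<in> (\<lambda>f. y + (\<chi> i. of_int (f i))) ` (PiE UNIV (\<lambda>_. {-n..n}))"
      by (rule image_eqI)
  qed
  then show ?thesis by (rule finite_subset) (simp add: finite_PiE)
qed

section \<open>Coordinates of a simplex relative to a facet and its apex\<close>

text \<open>Indexing the facet vertices by the coordinate type makes \<open>edge_map\<close> an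
  endomorphism of \<open>real ^ 'n\<close>.\<close>

locale indexed_simplex =
  fixes p :: "real ^ 'n" and h :: "'n \<Rightarrow> real ^ 'n"
  assumes inj_h: "inj h" and p_notin: "p \<notin> range h"
    and independent: "\<not> affine_dependent (insert p (range h))"
begin

abbreviation "S \<equiv> convex hull (insert p (range h))"

definition edge_map :: "real ^ 'n \<Rightarrow> real ^ 'n" where
  "edge_map y = (\<Sum>i\<in>UNIV. y $ i *\<^sub>R (h i - p))"

definition coords :: "real ^ 'n \<Rightarrow> real ^ 'n" where
  "coords = inv edge_map"

text \<open>The functional \<open>l\<close> of the overview. Translation by \<open>w\<close> changes
  the barycentric coordinate at \<open>h i\<close> by \<open>coords w $ i\<close>; the changes at
  all vertices cancel, so this is the change at \<open>p\<close>.\<close>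

definition apex_coord :: "real ^ 'n \<Rightarrow> real" where
  "apex_coord w = - (\<Sum>i\<in>UNIV. coords w $ i)"

lemma sum_range: "(\<Sum>v\<in>range h. g v) = (\<Sum>i\<in>UNIV. g (h i))"
  using inj_h by (simp add: sum.reindex)

lemma sum_vertices: "(\<Sum>v\<in>insert p (range h). g v) = g p + (\<Sum>i\<in>UNIV. g (h i))"
  using p_notin by (simp add: sum_range)

text \<open>Turns indexed weights into a function on points, the form in which affine dependence and
  interiors of convex hulls are described.\<close>

definition vertex_weights :: "real \<Rightarrow> ('n \<Rightarrow> real) \<Rightarrow> real ^ 'n \<Rightarrow> real" where
  "vertex_weights a0 a v = (if v = p then a0 else a (inv h v))"

lemma vertex_weights [simp]: "vertex_weights a0 a p = a0" "vertex_weights a0 a (h i) = a i"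
  using p_notin inj_h by (auto simp: vertex_weights_def)

lemma linear_edge_map: "linear edge_map"
  unfolding edge_map_def by (intro linearI) (simp_all add: scaleR_left_distrib sum.distrib scaleR_sum_right)

text \<open>A kernel vector \<open>y\<close> would give an affine dependence with weight
  \<open>y $ i\<close> at \<open>h i\<close>, the weight at \<open>p\<close> being chosen so that
  the total is 0.\<close>

lemma inj_edge_map: "inj edge_map"
  unfolding linear_injective_0[OF linear_edge_map]
proof (intro allI impI)
  fix y assume "edge_map y = 0"
  then have eq: "(\<Sum>i\<in>UNIV. y $ i *\<^sub>R h i) - (\<Sum>i\<in>UNIV. y $ i) *\<^sub>R p = 0"
    by (simp add: edge_map_def scaleR_right_diff_distrib sum_subtractf scaleR_left.sum)
  let ?U = "vertex_weights (- (\<Sum>i\<in>UNIV. y $ i)) (\<lambda>i. y $ i)"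
  have "sum ?U (insert p (range h)) = 0" "(\<Sum>v\<in>insert p (range h). ?U v *\<^sub>R v) = 0"
    using eq unfolding sum_vertices by simp_all
  moreover have "finite (insert p (range h))" by simp
  ultimately have "\<forall>v\<in>insert p (range h). ?U v = 0"
    using independent affine_dependent_explicit_finite by blast
  then have "\<forall>i. y $ i = 0" by simp
  then show "y = 0" by (simp add: vec_eq_iff)
qed

lemma coords_edge_map [simp]: "coords (edge_map y) = y"
  unfolding coords_def using inj_edge_map by simp

lemma edge_map_coords [simp]: "edge_map (coords y) = y"
  unfolding coords_def using linear_injective_imp_surjective[OF linear_edge_map inj_edge_map refl]
  by (rule surj_f_inv_f)

lemma linear_coords: "linear coords"
proof (rule linearI)
  show "coords (a + b) = coords a + coords b" for a b
    using coords_edge_map[of "coords a + coords b"] by (simp only: linear_add[OF linear_edge_map] edge_map_coords)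
  show "coords (r *\<^sub>R a) = r *\<^sub>R coords a" for r a
    using coords_edge_map[of "r *\<^sub>R coords a"] by (simp only: linear_scale[OF linear_edge_map] edge_map_coords)
qed

lemma linear_apex_coord: "linear apex_coord"
  unfolding apex_coord_def using linear_coords
  by (intro linearI) (simp_all add: linear_add linear_scale sum.distrib sum_distrib_left)

lemma edge_map_image: "edge_map ` A = coords -` A"
  by (metis bij_betw_imageI bij_vimage_eq_inv_image coords_def inj_edge_map inv_inv_eq linear_edge_map
      linear_injective_imp_surjective surj_imp_inj_inv inj_imp_surj_inv)

lemma add_eq_vertex_combination:
  "(\<Sum>i\<in>UNIV. b i *\<^sub>R h i) + w = (\<Sum>i\<in>UNIV. (b i + coords w $ i) *\<^sub>R h i) + apex_coord w *\<^sub>R p"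
proof -
  have "w = (\<Sum>i\<in>UNIV. coords w $ i *\<^sub>R (h i - p))"
    using edge_map_coords[of w] by (simp add: edge_map_def)
  also have "\<dots> = (\<Sum>i\<in>UNIV. coords w $ i *\<^sub>R h i) + apex_coord w *\<^sub>R p"
    by (simp add: apex_coord_def scaleR_right_diff_distrib sum_subtractf scaleR_left.sum)
  finally show ?thesis by (simp add: scaleR_left_distrib sum.distrib)
qed

lemma in_interiorI:
  assumes "\<And>i. 0 < a i" "0 < a0" "a0 + (\<Sum>i\<in>UNIV. a i) = 1"
  shows "(\<Sum>i\<in>UNIV. a i *\<^sub>R h i) + a0 *\<^sub>R p \<in> interior S"
proof -
  \<comment> \<open>With one vertex more than the dimension the simplex is full-dimensional, so
    positive weights describe its interior.\<close>
  have "card (insert p (range h)) = Suc CARD('n)"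
    using p_notin inj_h by (simp add: card_image)
  moreover have "\<exists>u. (\<forall>x\<in>insert p (range h). 0 < u x) \<and> sum u (insert p (range h)) = 1 \<and>
      (\<Sum>x\<in>insert p (range h). u x *\<^sub>R x) = (\<Sum>i\<in>UNIV. a i *\<^sub>R h i) + a0 *\<^sub>R p"
    unfolding sum_vertices using assms by (intro exI[of _ "vertex_weights a0 a"]) simp
  ultimately show ?thesis
    unfolding interior_convex_hull_explicit_minimal[OF independent] by simp
qed

lemma in_rel_interior_facetI:
  assumes "\<And>i. 0 < a i" "(\<Sum>i\<in>UNIV. a i) = 1"
  shows "(\<Sum>i\<in>UNIV. a i *\<^sub>R h i) \<in> rel_interior (convex hull (range h))"
proof -
  have "\<not> affine_dependent (range h)"
    using independent affine_dependent_subset by blast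
  moreover have "\<exists>u. (\<forall>x\<in>range h. 0 < u x) \<and> sum u (range h) = 1 \<and>
      (\<Sum>x\<in>range h. u x *\<^sub>R x) = (\<Sum>i\<in>UNIV. a i *\<^sub>R h i)"
    \<comment> \<open>The value 1 at \<open>p\<close> is a placeholder: \<open>p\<close> is not a
      vertex of the facet.\<close>
    unfolding sum_range using assms by (intro exI[of _ "vertex_weights 1 a"]) simp
  ultimately show ?thesis
    by (simp add: rel_interior_convex_hull_explicit)
qed

text \<open>Half-widths \<open>b i / 2\<close> make every coordinate of a difference of two points
  exceed \<open>- b i\<close>, so adding it to \<open>b i\<close> leaves a positive weight.\<close>

definition facet_box :: "('n \<Rightarrow> real) \<Rightarrow> (real ^ 'n) set" where
  "facet_box b = coords -` box (\<chi> i. - b i / 2) (\<chi> i. b i / 2)"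

lemma mem_facet_box: "y \<in> facet_box b \<longleftrightarrow> (\<forall>i. \<bar>coords y $ i\<bar> < b i / 2)"
proof -
  have "- b i / 2 < r \<and> r < b i / 2 \<longleftrightarrow> \<bar>r\<bar> < b i / 2" for i r
    by (rule iffI, linarith, intro conjI; linarith)
  then show ?thesis
    by (simp only: facet_box_def vimage_eq mem_box_cart vec_lambda_beta)
qed

lemma open_facet_box: "open (facet_box b)"
  unfolding facet_box_def
  by (intro open_vimage open_box linear_continuous_on linear_linear[THEN iffD2] linear_coords)

lemma bounded_facet_box: "bounded (facet_box b)"
  unfolding facet_box_def edge_map_image[symmetric]
  by (intro bounded_linear_image bounded_box) (simp add: linear_linear linear_edge_map)

text \<open>Preimages under \<open>coords\<close> scale all volumes by one factor. It is read off
  from the standard simplex, whose volume is \<open>1 / fact CARD('n)\<close> and whose preimage is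
  \<open>S\<close> translated by \<open>- p\<close>.\<close>

lemma emeasure_facet_box:
  assumes "\<And>i. 0 < b i"
  shows "emeasure lborel (facet_box b) = ennreal (fact CARD('n) * measure lebesgue S * (\<Prod>i\<in>UNIV. b i))"
proof -
  define std where "std = (convex hull (insert 0 Basis) :: (real ^ 'n) set)"
  have "edge_map (axis i 1) = h i - p" for i
    by (simp add: edge_map_def axis_def if_distrib[of "\<lambda>r. r *\<^sub>R _"] cong: if_cong)
  then have "edge_map ` Basis = (\<lambda>i. h i - p) ` UNIV"
    by (auto simp: Basis_vec_def image_iff)
  then have "edge_map ` insert 0 Basis = (+) (- p) ` insert p (range h)"
    using linear_0[OF linear_edge_map] by (auto simp: image_iff)
  then have "edge_map ` std = (+) (- p) ` S"
    unfolding std_def by (simp only: convex_hull_linear_image[OF linear_edge_map] convex_hull_translation)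
  then have cs: "coords -` std = (+) (- p) ` S" by (simp add: edge_map_image)
  have "compact std" by (simp add: std_def finite_imp_compact_convex_hull)
  then have std_borel: "std \<in> sets borel" by (simp add: compact_imp_closed)
  have compact: "compact (coords -` std)"
    unfolding cs by (intro compact_translation finite_imp_compact_convex_hull) simp
  then have "measure lebesgue (coords -` std) = measure lborel (coords -` std)"
    by (intro measure_completion) (auto dest: compact_imp_closed)
  then have "measure lborel (coords -` std) = measure lebesgue S"
    unfolding cs measure_translation by simp
  then have vol_S: "emeasure lborel (coords -` std) = ennreal (measure lebesgue S)"
    using emeasure_eq_ennreal_measure[of lborel "coords -` std"] emeasure_compact_finite[OF compact] by simp
  have vol_box: "emeasure lborel (box (\<chi> i. - b i / 2) (\<chi> i. b i / 2)) = ennreal (\<Prod>i\<in>UNIV. b i)"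
  proof -
    have B: "Basis = range (\<lambda>i. axis i 1 :: real ^ 'n)"
      by (auto simp: Basis_vec_def)
    have "(\<Prod>e\<in>Basis. ((\<chi> i. b i / 2) - (\<chi> i. - b i / 2)) \<bullet> e) = (\<Prod>i\<in>UNIV. b i)"
      unfolding B by (subst prod.reindex) (auto simp: inj_on_def axis_eq_axis inner_axis)
    moreover have "(\<chi> i. - b i / 2) \<bullet> e \<le> (\<chi> i. b i / 2) \<bullet> e" if "e \<in> Basis" for e
      using that assms unfolding B by (auto simp: inner_axis less_imp_le)
    ultimately show ?thesis
      by (subst emeasure_lborel_box) simp_all
  qed
  have "emeasure lborel (facet_box b) * ennreal (1 / fact CARD('n)) = ennreal (measure lebesgue S) * ennreal (\<Prod>i\<in>UNIV. b i)"
    using emeasure_linear_vimage_proportional[OF linear_edge_map linear_coords coords_edge_map borel_open[OF open_box] std_borel,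
        of "\<chi> i. - b i / 2" "\<chi> i. b i / 2"]
    by (simp only: facet_box_def vol_S vol_box emeasure_std_simplex[where 'a = "real ^ 'n", folded std_def] DIM_cart DIM_real mult_1_right)
  then have "emeasure lborel (facet_box b) * (ennreal (1 / fact CARD('n)) * ennreal (fact CARD('n)))
     = ennreal (measure lebesgue S) * ennreal (\<Prod>i\<in>UNIV. b i) * ennreal (fact CARD('n))"
    by (simp only: mult.assoc[symmetric])
  moreover have "ennreal (1 / fact CARD('n)) * ennreal (fact CARD('n)) = 1"
    by (subst ennreal_mult[symmetric]) simp_all
  moreover have "ennreal (measure lebesgue S) * ennreal (\<Prod>i\<in>UNIV. b i) * ennreal (fact CARD('n))
      = ennreal (measure lebesgue S * (\<Prod>i\<in>UNIV. b i) * fact CARD('n))"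
    using assms by (simp only: ennreal_mult prod_nonneg less_imp_le measure_nonneg mult_nonneg_nonneg fact_ge_zero)
  ultimately have "emeasure lborel (facet_box b) * 1 = ennreal (measure lebesgue S * (\<Prod>i\<in>UNIV. b i) * fact CARD('n))"
    by (simp only:)
  then show ?thesis by (simp add: mult.commute mult.left_commute)
qed

end

section \<open>Positions in an interval from which a step leads outside\<close>

text \<open>For positive \<open>B\<close> and nonzero \<open>c\<close>, a point of the open interval
  from \<open>- B / 2\<close> to \<open>B / 2\<close> lying less than one step \<open>c\<close> from
  the end in the direction of \<open>c\<close>: at distance \<open>\<bar>c\<bar> / 2\<close> from
  it, or at the midpoint if \<open>\<bar>c\<bar> \<ge> B\<close>.\<close>

definition corner :: "real \<Rightarrow> real \<Rightarrow> real" where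
  "corner c B = sgn c * max 0 (B / 2 - \<bar>c\<bar> / 2)"

lemma corner_bound: "c \<noteq> 0 \<Longrightarrow> 0 < B \<Longrightarrow> \<bar>corner c B\<bar> < B / 2"
  by (cases "0 < c") (simp_all add: corner_def max_def)

lemma corner_near_face: "c \<noteq> 0 \<Longrightarrow> 0 < B \<Longrightarrow> B / 2 < sgn c * corner c B + \<bar>c\<bar>"
  by (cases "0 < c") (simp_all add: corner_def max_def)

text \<open>The condition on \<open>r\<close> is a strict inequality, so it defines an open set of
  positions around the corner.\<close>

lemma step_leaves_box:
  fixes c r B :: real
  assumes "c \<noteq> 0" "B / 2 < sgn c * r + \<bar>c\<bar>"
  shows "\<not> \<bar>r + c\<bar> < B / 2"
proof (cases "0 < c")
  case True
  then show ?thesis using assms(2) abs_ge_self[of "r + c"] by (simp only: sgn_pos abs_of_pos)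
next
  case False
  then have "c < 0" using assms(1) by simp
  then show ?thesis using assms(2) abs_ge_minus_self[of "r + c"] by (simp only: sgn_neg abs_of_neg)
qed

section \<open>The box of a facet lattice point and the volume bound\<close>

locale facet_lattice_point = indexed_simplex p h
  for p :: "real ^ 'n" and h :: "'n \<Rightarrow> real ^ 'n" +
  fixes x :: "real ^ 'n" and b :: "'n \<Rightarrow> real"
  assumes b_pos: "\<And>i. 0 < b i" and b_sum: "(\<Sum>i\<in>UNIV. b i) = 1"
    and x_eq: "x = (\<Sum>i\<in>UNIV. b i *\<^sub>R h i)"
    and facet_point: "rel_interior (convex hull (range h)) \<inter> integer_lattice = {x}"
begin

text \<open>The interior lattice points as seen from \<open>x\<close>. Differences of box points are
  vectors, so this is the set \<open>D\<close> to which the counting lemmas are applied.\<close>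

definition interior_vectors :: "(real ^ 'n) set" where
  "interior_vectors = {w\<in>integer_lattice. x + w \<in> interior S}"

lemma x_lattice: "x \<in> integer_lattice"
  using facet_point by blast

lemma interior_vectors_image: "(+) x ` interior_vectors = interior S \<inter> integer_lattice"
proof (intro subset_antisym subsetI)
  fix y assume "y \<in> (+) x ` interior_vectors"
  then show "y \<in> interior S \<inter> integer_lattice"
    by (auto simp: interior_vectors_def integer_lattice_add[OF x_lattice])
next
  fix y assume "y \<in> interior S \<inter> integer_lattice"
  then have "y - x \<in> interior_vectors"
    by (simp add: interior_vectors_def integer_lattice_diff[OF _ x_lattice])
  then show "y \<in> (+) x ` interior_vectors"
    by (rule rev_image_eqI) simp
qed

lemma card_interior_vectors: "card interior_vectors = card (interior S \<inter> integer_lattice)"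
  unfolding interior_vectors_image[symmetric] by (simp add: card_image)

lemma finite_interior_vectors: "finite interior_vectors"
proof -
  have "bounded (interior S)"
    by (intro bounded_interior finite_imp_bounded_convex_hull) simp
  then have "finite (lattice_translates (interior S) 0)"
    by (rule finite_bounded_lattice_translates)
  then have "finite ((+) x ` interior_vectors)"
    unfolding interior_vectors_image by (simp add: lattice_translates_def Int_def)
  then show ?thesis by (rule finite_imageD) simp
qed

lemma facet_box_diff:
  assumes "a \<in> facet_box b" "a' \<in> facet_box b"
  shows "0 < b i + coords (a' - a) $ i"
  using assms[unfolded mem_facet_box, rule_format, of i]
  unfolding linear_diff[OF linear_coords] vector_minus_component by linarith

lemma sum_shifted_coords: "apex_coord w + (\<Sum>i\<in>UNIV. b i + coords w $ i) = 1"
  by (simp add: apex_coord_def sum.distrib b_sum)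

text \<open>The weights of \<open>x + (a' - a)\<close> are positive at the facet vertices by the
  choice of the half-widths, and at the apex because \<open>apex_coord\<close> increases.\<close>

lemma facet_box_positive_difference:
  assumes "a \<in> facet_box b" "a' \<in> facet_box b" "a' - a \<in> integer_lattice" "apex_coord a < apex_coord a'"
  shows "a' - a \<in> interior_vectors"
proof -
  have "x + (a' - a) = (\<Sum>i\<in>UNIV. (b i + coords (a' - a) $ i) *\<^sub>R h i) + apex_coord (a' - a) *\<^sub>R p"
    unfolding x_eq by (rule add_eq_vertex_combination)
  also have "\<dots> \<in> interior S"
    using assms(4) by (intro in_interiorI facet_box_diff[OF assms(1,2)] sum_shifted_coords) (simp add: linear_diff[OF linear_apex_coord])
  finally show ?thesis using assms(3) by (simp add: interior_vectors_def)
qed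

text \<open>With weight 0 at the apex, \<open>x + (a' - a)\<close> is a lattice point in the
  relative interior of the facet, hence equal to \<open>x\<close>. Thus \<open>apex_coord\<close>
  separates the points of a coset in the box.\<close>

lemma facet_box_zero_difference:
  assumes "a \<in> facet_box b" "a' \<in> facet_box b" "a' - a \<in> integer_lattice" "apex_coord a = apex_coord a'"
  shows "a = a'"
proof -
  have 0: "apex_coord (a' - a) = 0" using assms(4) by (simp add: linear_diff[OF linear_apex_coord])
  have "x + (a' - a) = (\<Sum>i\<in>UNIV. (b i + coords (a' - a) $ i) *\<^sub>R h i) + apex_coord (a' - a) *\<^sub>R p"
    unfolding x_eq by (rule add_eq_vertex_combination)
  also have "\<dots> = (\<Sum>i\<in>UNIV. (b i + coords (a' - a) $ i) *\<^sub>R h i)" using 0 by simp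
  also have "\<dots> \<in> rel_interior (convex hull (range h))"
    using sum_shifted_coords[of "a' - a"] 0 by (intro in_rel_interior_facetI facet_box_diff[OF assms(1,2)]) simp
  finally have "x + (a' - a) \<in> rel_interior (convex hull (range h)) \<inter> integer_lattice"
    using integer_lattice_add[OF x_lattice assms(3)] by blast
  then show ?thesis unfolding facet_point by simp
qed

abbreviation "translates \<equiv> lattice_translates (facet_box b)"

lemma finite_translates: "finite (translates y)"
  by (rule finite_bounded_lattice_translates[OF bounded_facet_box])

lemma translates_diff: "a \<in> translates y \<Longrightarrow> a' \<in> translates y \<Longrightarrow> a' - a \<in> integer_lattice"
  using integer_lattice_diff[of "a' - y" "a - y"] by (simp add: lattice_translates_def)

lemma translates_subset: "a \<in> translates y \<Longrightarrow> a \<in> facet_box b"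
  by (simp add: lattice_translates_def)

lemma inj_on_apex_coord: "inj_on apex_coord (translates y)"
  using facet_box_zero_difference translates_diff translates_subset unfolding inj_on_def by blast

lemma translates_positive_difference:
  "a \<in> translates y \<Longrightarrow> a' \<in> translates y \<Longrightarrow> apex_coord a < apex_coord a' \<Longrightarrow> a' - a \<in> interior_vectors"
  using facet_box_positive_difference translates_diff translates_subset by blast

lemma card_translates_le: "card (translates y) \<le> Suc (card interior_vectors)"
proof (cases "translates y = {}")
  case False
  obtain q where "(\<lambda>a. a - q) ` (translates y - {q}) \<subseteq> interior_vectors"
    "card (translates y) = Suc (card ((\<lambda>a. a - q) ` (translates y - {q})))"
    by (rule minimal_element_differences[OF finite_interior_vectors finite_translates inj_on_apex_coord
          translates_positive_difference False])
  then show ?thesis using card_mono[OF finite_interior_vectors] by simp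
qed simp

lemma facet_box_borel: "facet_box b \<in> sets borel"
  by (simp add: open_facet_box borel_open)

lemma volume_le:
  "measure lebesgue S \<le> (real (card interior_vectors) + 1) / (fact CARD('n) * (\<Prod>i\<in>UNIV. b i))"
proof -
  have "emeasure lborel (facet_box b) \<le> of_nat (Suc (card interior_vectors))"
    by (intro lattice_covering_volume_le facet_box_borel finite_translates card_translates_le)
  then have "ennreal (fact CARD('n) * measure lebesgue S * (\<Prod>i\<in>UNIV. b i)) \<le> ennreal (real (Suc (card interior_vectors)))"
    by (simp add: emeasure_facet_box b_pos ennreal_of_nat_eq_real_of_nat)
  then have "fact CARD('n) * measure lebesgue S * (\<Prod>i\<in>UNIV. b i) \<le> real (Suc (card interior_vectors))"
    by (subst (asm) ennreal_le_iff) simp_all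
  moreover have "0 < (\<Prod>i\<in>UNIV. b i)" by (simp add: prod_pos b_pos)
  ultimately show ?thesis by (simp add: pos_le_divide_eq mult_ac)
qed

section \<open>Direction of the interior lattice points in the equality case\<close>

lemma extremal_direction:
  assumes eq: "measure lebesgue S = (real (card interior_vectors) + 1) / (fact CARD('n) * (\<Prod>i\<in>UNIV. b i))"
    and ne: "interior_vectors \<noteq> {}"
  obtains t i where "t \<noteq> 0" "\<And>w. w \<in> interior_vectors \<Longrightarrow> \<exists>n::nat. w = real n *\<^sub>R t *\<^sub>R (h i - p)"
proof -
  let ?D = interior_vectors
  have "b i \<noteq> 0" for i using b_pos[of i] by simp
  then have "fact CARD('n) * measure lebesgue S * (\<Prod>i\<in>UNIV. b i) = real (Suc (card ?D))"
    by (simp add: eq)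
  then have "emeasure lborel (facet_box b) = of_nat (Suc (card ?D))"
    by (simp only: emeasure_facet_box[OF b_pos] ennreal_of_nat_eq_real_of_nat)
  \<comment> \<open>Equality means that the box has volume exactly \<open>k + 1\<close>, so every
    nonempty open set contains a \<open>y\<close> whose coset attains the maximal count.\<close>
  from lattice_covering_extremal[OF facet_box_borel finite_translates card_translates_le this]
  have extremal: "\<exists>y\<in>G. card (translates y) = Suc (card ?D)" if "open G" "G \<noteq> {}" for G
    using that by blast
  have "Min (apex_coord ` ?D) \<in> apex_coord ` ?D"
    using ne finite_interior_vectors by (intro Min_in) auto
  \<comment> \<open>The step \<open>u\<close> is chosen from the interior vectors alone, so it is
    the same for all cosets attaining the maximum.\<close>
  then obtain u where u: "u \<in> ?D" and "apex_coord u = Min (apex_coord ` ?D)" by auto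
  then have umin: "apex_coord u \<le> apex_coord w" if "w \<in> ?D" for w
    using that finite_interior_vectors by simp
  note chain = difference_chain_extremal[OF linear_apex_coord finite_interior_vectors finite_translates
      inj_on_apex_coord translates_positive_difference _ u umin]
  have neighbour: "a + u \<in> translates y \<or> a - u \<in> translates y"
    if "card (translates y) = Suc (card ?D)" "a \<in> translates y" for a y
    by (rule chain(2)[OF _ _ _ that(1) _ that(2)]) assumption+
  obtain y where y: "card (translates y) = Suc (card ?D)"
    using extremal[of UNIV] by auto
  have multiples: "\<exists>n::nat. w = real n *\<^sub>R u" if "w \<in> ?D" for w
    by (rule chain(1)[OF _ _ _ y _ that]) assumption+
  have "0 < apex_coord u"
    by (rule chain(3)[OF _ _ _ y]) assumption+
  have "\<exists>i. coords u $ i \<noteq> 0"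
  proof (rule ccontr)
    assume "\<not> ?thesis"
    then have "apex_coord u = 0" by (simp add: apex_coord_def)
    with \<open>0 < apex_coord u\<close> show False by simp
  qed
  then obtain i where i: "coords u $ i \<noteq> 0" by blast
  have "coords u $ j = 0" if "j \<noteq> i" for j
  proof (rule ccontr)
    assume j: "coords u $ j \<noteq> 0"
    \<comment> \<open>From points of \<open>G\<close> the step \<open>u\<close> leaves the box
      through a face in coordinate \<open>i\<close>, and the step \<open>- u\<close> through one in
      coordinate \<open>j\<close>; hence the opposite sign at \<open>j\<close>.\<close>
    define G where "G = facet_box b \<inter>
      {y. b i / 2 < sgn (coords u $ i) * coords y $ i + \<bar>coords u $ i\<bar>} \<inter>
      {y. b j / 2 < sgn (- coords u $ j) * coords y $ j + \<bar>- coords u $ j\<bar>}"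
    have cont: "continuous_on UNIV (\<lambda>y. coords y $ m)" for m
      by (intro continuous_on_component linear_continuous_on) (simp add: linear_conv_bounded_linear[symmetric] linear_coords)
    have "open G"
      unfolding G_def by (intro open_Int open_facet_box open_Collect_less continuous_intros cont)
    \<comment> \<open>Coordinates of a point of \<open>G\<close>: the corner positions for
      \<open>u\<close> at \<open>i\<close> and \<open>- u\<close> at \<open>j\<close>, and the
      centre of the box elsewhere.\<close>
    define s where "s = (\<chi> m. if m = i then corner (coords u $ i) (b i)
       else if m = j then corner (- coords u $ j) (b j) else 0)"
    have si: "s $ i = corner (coords u $ i) (b i)" and sj: "s $ j = corner (- coords u $ j) (b j)"
      using that by (simp_all add: s_def)
    have nj: "- coords u $ j \<noteq> 0" using j by simp
    have "\<bar>s $ m\<bar> < b m / 2" for m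
    proof (cases "m = i \<or> m = j")
      case True
      then show ?thesis
        using corner_bound[OF i b_pos[of i]] corner_bound[OF nj b_pos[of j]] unfolding si[symmetric] sj[symmetric] by blast
    next
      case False
      then show ?thesis using b_pos[of m] by (simp add: s_def)
    qed
    moreover have "b i / 2 < sgn (coords u $ i) * s $ i + \<bar>coords u $ i\<bar>"
      unfolding si by (rule corner_near_face[OF i b_pos])
    moreover have "b j / 2 < sgn (- coords u $ j) * s $ j + \<bar>- coords u $ j\<bar>"
      unfolding sj by (rule corner_near_face[OF nj b_pos])
    ultimately have "edge_map s \<in> G"
      unfolding G_def Int_iff mem_Collect_eq mem_facet_box coords_edge_map by blast
    then obtain y where y: "y \<in> G" "card (translates y) = Suc (card ?D)"
      using extremal[OF \<open>open G\<close>] by blast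
    have "y \<in> translates y"
      using y(1) integer_lattice_0 by (simp add: lattice_translates_def G_def)
    then have "y + u \<in> translates y \<or> y - u \<in> translates y"
      by (rule neighbour[OF y(2)])
    then show False
    proof
      assume "y + u \<in> translates y"
      then have "\<bar>coords y $ i + coords u $ i\<bar> < b i / 2"
        using translates_subset[of "y + u" y] by (simp add: mem_facet_box linear_add[OF linear_coords])
      moreover have "b i / 2 < sgn (coords u $ i) * coords y $ i + \<bar>coords u $ i\<bar>" using y(1) by (simp add: G_def)
      ultimately show False
        using step_leaves_box[OF i] by blast
    next
      assume "y - u \<in> translates y"
      then have "\<bar>coords y $ j + - coords u $ j\<bar> < b j / 2"
        using translates_subset[of "y - u" y] by (simp add: mem_facet_box linear_diff[OF linear_coords])
      moreover have "b j / 2 < sgn (- coords u $ j) * coords y $ j + \<bar>- coords u $ j\<bar>" using y(1) by (simp add: G_def)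
      ultimately show False
        using step_leaves_box[OF nj] by blast
    qed
  qed
  then have other: "coords u $ m *\<^sub>R (h m - p) = (if m = i then coords u $ i *\<^sub>R (h i - p) else 0)" for m
    by simp
  have "u = (\<Sum>m\<in>UNIV. coords u $ m *\<^sub>R (h m - p))"
    using edge_map_coords[of u] by (simp only: edge_map_def)
  also have "\<dots> = coords u $ i *\<^sub>R (h i - p)"
    by (subst sum.cong[OF refl other]) simp
  finally have "u = coords u $ i *\<^sub>R (h i - p)" .
  with multiples i that show ?thesis by metis
qed

text \<open>Any subset of affinely independent vertices spans a face of their hull, and two distinct
  vertices span one of dimension 1.\<close>

lemma apex_edge: "convex hull {p, h i} edge_of S"
proof -
  have "p \<noteq> h i" using p_notin by blast
  then have "aff_dim (convex hull {p, h i}) = 1" by (simp add: aff_dim_convex_hull aff_dim_2)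
  moreover have "convex hull {p, h i} face_of S"
    unfolding face_of_convex_hull_affine_independent[OF independent] by (intro exI[of _ "{p, h i}"]) simp
  ultimately show ?thesis by (simp add: edge_of_def)
qed

lemma extremal_line:
  assumes "measure lebesgue S = (real (card interior_vectors) + 1) / (fact CARD('n) * (\<Prod>i\<in>UNIV. b i))"
    and "interior_vectors \<noteq> {}"
  shows "\<exists>g. is_line g \<and> x \<in> g \<and> interior S \<inter> integer_lattice \<subseteq> g \<and> has_edge_parallel_to S g"
proof -
  obtain t i where w: "\<And>w. w \<in> interior_vectors \<Longrightarrow> \<exists>n::nat. w = real n *\<^sub>R t *\<^sub>R (h i - p)"
    using extremal_direction[OF assms] by blast
  \<comment> \<open>The line spanned by the edge from \<open>p\<close> to \<open>h i\<close>, moved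
    so that \<open>p\<close> goes to \<open>x\<close>; parallelism holds by construction.\<close>
  define g where "g = (+) (x - p) ` (affine hull {p, h i})"
  have "p \<noteq> h i" using p_notin by blast
  then have "is_line g"
    unfolding is_line_def g_def by (simp add: affine_translation[symmetric] aff_dim_translation_eq aff_dim_2)
  moreover have mem: "x + r *\<^sub>R (h i - p) \<in> g" for r
  proof -
    have "(1 - r) *\<^sub>R p + r *\<^sub>R h i \<in> affine hull {p, h i}"
      unfolding affine_hull_2 by (intro CollectI exI[of _ "1 - r"] exI[of _ r]) simp
    then show ?thesis
      unfolding g_def by (rule rev_image_eqI) (simp add: algebra_simps)
  qed
  moreover have "interior S \<inter> integer_lattice \<subseteq> g"
    unfolding interior_vectors_image[symmetric] using w mem by (metis image_subsetI scaleR_scaleR)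
  moreover have "has_edge_parallel_to S g"
    unfolding has_edge_parallel_to_def affine_parallel_def
    using apex_edge[of i] g_def by (metis affine_hull_convex_hull)
  ultimately show ?thesis using mem[of 0] by auto
qed

end

section \<open>Passage from the given facet to an indexed simplex\<close>

theorem theorem1p2:
  fixes S F V :: "(real ^ 'n) set"
    and x :: "real ^ 'n"
    and k :: nat
    and \<beta> :: "real ^ 'n \<Rightarrow> real"
  assumes simplex_S: "int CARD('n) simplex S"
    and interior_points: "card (interior S \<inter> integer_lattice) = k"
    and facet_F: "F facet_of S"
    and facet_point: "rel_interior F \<inter> integer_lattice = {x}"
    and vertices_F: "\<not> affine_dependent V" "F = convex hull V"
    and barycentric: "barycentric_coordinates V x \<beta>"
    and positive: "\<forall>v\<in>V. \<beta> v > 0"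
  shows "measure lebesgue S \<le> (real k + 1) / (fact CARD('n) * (\<Prod>v\<in>V. \<beta> v)) \<and>
    (k \<ge> 1 \<and> measure lebesgue S = (real k + 1) / (fact CARD('n) * (\<Prod>v\<in>V. \<beta> v)) \<longrightarrow>
      (\<exists>g. is_line g \<and> x \<in> g \<and> interior S \<inter> integer_lattice \<subseteq> g \<and>
           has_edge_parallel_to S g))"
proof -
  obtain C where C: "\<not> affine_dependent C" "int (card C) = int CARD('n) + 1" "S = convex hull C"
    using simplex_S unfolding simplex_def by blast
  obtain p where p: "p \<in> C" "F = convex hull (C - {p})"
    using facet_F facet_of_convex_hull_affine_independent[OF C(1), of F] C(3) by blast
  have "\<not> affine_dependent (C - {p})"
    using C(1) affine_dependent_subset by blast
  \<comment> \<open>Both \<open>V\<close> and \<open>C - {p}\<close> are the set of extreme points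
    of \<open>F\<close>, so the given vertices of \<open>F\<close> are those of \<open>S\<close>
    without \<open>p\<close>.\<close>
  from extreme_point_of_convex_hull_affine_independent[OF this]
    extreme_point_of_convex_hull_affine_independent[OF vertices_F(1)]
  have V: "V = C - {p}"
    unfolding vertices_F(2)[symmetric] p(2)[symmetric] by blast
  have "finite C" using C(1) aff_independent_finite by blast
  \<comment> \<open>A full-dimensional simplex has one vertex more than the dimension; without
    \<open>p\<close> the number matches the coordinate type, which can therefore index
    \<open>V\<close>.\<close>
  then have "card V = CARD('n)" using C(2) p(1) by (simp add: V)
  then obtain h :: "'n \<Rightarrow> real ^ 'n" where h: "bij_betw h UNIV V"
    using \<open>finite C\<close> finite_same_card_bij[of "UNIV :: 'n set" V] by (auto simp: V)
  then have Vh: "V = range h" and inj: "inj h"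
    by (auto simp: bij_betw_def)
  have Ch: "C = insert p (range h)" using V p(1) unfolding Vh[symmetric] by blast
  interpret facet_lattice_point p h x "\<lambda>i. \<beta> (h i)"
  proof
    show "inj h" by fact
    show "p \<notin> range h" using V Vh by blast
    show "\<not> affine_dependent (insert p (range h))" using C(1) Ch by simp
    show "0 < \<beta> (h i)" for i using positive Vh by blast
    show "(\<Sum>i\<in>UNIV. \<beta> (h i)) = 1" "x = (\<Sum>i\<in>UNIV. \<beta> (h i) *\<^sub>R h i)"
      using barycentric unfolding barycentric_coordinates_def Vh by (simp_all add: sum.reindex[OF inj] o_def)
    show "rel_interior (convex hull (range h)) \<inter> integer_lattice = {x}"
      using facet_point unfolding vertices_F(2) Vh .
  qed
  have S: "S = convex hull (insert p (range h))"
    using C(3) unfolding Ch .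
  have k: "card interior_vectors = k"
    using interior_points unfolding card_interior_vectors S .
  have prod: "(\<Prod>v\<in>V. \<beta> v) = (\<Prod>i\<in>UNIV. \<beta> (h i))"
    using inj by (simp add: Vh prod.reindex)
  show ?thesis
    unfolding S prod k[symmetric]
  proof (intro conjI impI volume_le)
    assume *: "1 \<le> card interior_vectors \<and> measure lebesgue (convex hull (insert p (range h))) =
      (real (card interior_vectors) + 1) / (fact CARD('n) * (\<Prod>i\<in>UNIV. \<beta> (h i)))"
    then have "interior_vectors \<noteq> {}" by auto
    with * show "\<exists>g. is_line g \<and> x \<in> g \<and>
        interior (convex hull (insert p (range h))) \<inter> integer_lattice \<subseteq> g \<and>
        has_edge_parallel_to (convex hull (insert p (range h))) g"
      by (intro extremal_line) simp_all
  qed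
qed

end
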